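(* Let $\phi\in\mathbb{R}[x_1,\dots,x_4]$ be a nonquadratic polynomial (i.e. $\deg(\phi)\neq2$) such that $\det(\operatorname{Hess}(\phi))$ is a nonzero constant. Suppose that $$\det(\operatorname{Hess}(\operatorname{in}_{\omega}(\phi)))\neq0$$ as a polynomial, for some positive weights $\omega=(\omega_1,\dots,\omega_4)$. Then there exists a nonzero vector $\xi\in\mathbb{R}^4$ such that $D_\xi^2\phi=0$.
   Context: Given positive weights $\omega=(\omega_1,\dots,\omega_4)$, a monomial $x^\alpha$ has weight $\langle\omega,\alpha\rangle=\sum_i\omega_i\alpha_i$, and $\operatorname{in}_\omega(\phi)$ denotes the component of $\phi$ of highest weight, i.e. the sum of all terms of $\phi$ whose monomials have the maximal weight among those occurring in $\phi$. $D_\xi$ denotes the directional derivative along $\xi$. *)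

theory Defs
  imports "HOL-Analysis.Analysis" "HOL-Library.Poly_Mapping" "HOL-Library.Numeral_Type"
begin

text \<open>
  A monomial is its exponent vector; a polynomial is the finitely supported map sending each
  exponent vector to its coefficient, with the convolution product of \<open>Poly_Mapping\<close>.
  Variables are indexed by the elements of the finite type \<open>'n\<close>.
\<close>

type_synonym 'n monom = "'n \<Rightarrow>\<^sub>0 nat"
type_synonym 'n rpoly = "'n monom \<Rightarrow>\<^sub>0 real"

definition const_poly :: "real \<Rightarrow> 'n::finite rpoly" where
  "const_poly c = Poly_Mapping.single 0 c"

text \<open>The zero polynomial gets degree 0.\<close>
definition total_degree :: "'n::finite rpoly \<Rightarrow> nat" where
  "total_degree p =
     Max (insert 0 ((\<lambda>\<alpha>. \<Sum>i\<in>UNIV. Poly_Mapping.lookup \<alpha> i) ` Poly_Mapping.keys p))"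

text \<open>
  The subtraction of exponents is truncated, which is harmless: the coefficient
  vanishes whenever \<open>i\<close> does not occur in the monomial.
\<close>
definition partial_deriv :: "'n::finite \<Rightarrow> 'n rpoly \<Rightarrow> 'n rpoly" where
  "partial_deriv i p =
     (\<Sum>\<alpha>\<in>Poly_Mapping.keys p.
        Poly_Mapping.single (\<alpha> - Poly_Mapping.single i 1)
          (real (Poly_Mapping.lookup \<alpha> i) * Poly_Mapping.lookup p \<alpha>))"

lemma lookup_partial_deriv:
  "Poly_Mapping.lookup (partial_deriv i p) \<beta> =
     real (Poly_Mapping.lookup \<beta> i + 1) * Poly_Mapping.lookup p (\<beta> + Poly_Mapping.single i 1)"
proof -
  let ?\<gamma> = "\<beta> + Poly_Mapping.single i 1"
  have eq: "Poly_Mapping.lookup (Poly_Mapping.single (\<alpha> - Poly_Mapping.single i 1)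
          (real (Poly_Mapping.lookup \<alpha> i) * Poly_Mapping.lookup p \<alpha>)) \<beta> =
      (if \<alpha> = ?\<gamma> then real (Poly_Mapping.lookup \<beta> i + 1) * Poly_Mapping.lookup p ?\<gamma> else 0)" for \<alpha>
  proof (cases "Poly_Mapping.lookup \<alpha> i = 0")
    case True
    then have "\<alpha> \<noteq> ?\<gamma>" by (auto simp: lookup_add)
    with True show ?thesis by simp
  next
    case False
    then have "\<alpha> - Poly_Mapping.single i 1 = \<beta> \<longleftrightarrow> \<alpha> = ?\<gamma>"
      by (auto simp: poly_mapping_eq_iff fun_eq_iff lookup_add lookup_minus lookup_single when_def)
    then show ?thesis
      by (auto simp: lookup_single when_def lookup_add)
  qed
  show ?thesis
    unfolding partial_deriv_def lookup_sum eq
    by (simp add: in_keys_iff)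
qed

definition hessian :: "'n::finite rpoly \<Rightarrow> 'n rpoly ^ 'n ^ 'n" where
  "hessian p = (\<chi> i j. partial_deriv i (partial_deriv j p))"

definition dir_deriv :: "real ^ 'n \<Rightarrow> 'n::finite rpoly \<Rightarrow> 'n rpoly" where
  "dir_deriv \<xi> p = (\<Sum>i\<in>UNIV. const_poly (\<xi> $ i) * partial_deriv i p)"

definition monom_weight :: "real ^ 'n \<Rightarrow> 'n::finite monom \<Rightarrow> real" where
  "monom_weight \<omega> \<alpha> = (\<Sum>i\<in>UNIV. \<omega> $ i * real (Poly_Mapping.lookup \<alpha> i))"

definition initial_form :: "real ^ 'n \<Rightarrow> 'n::finite rpoly \<Rightarrow> 'n rpoly" where
  "initial_form \<omega> p =
     (\<Sum>\<alpha> | \<alpha> \<in> Poly_Mapping.keys p \<and>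
            (\<forall>\<beta>\<in>Poly_Mapping.keys p. monom_weight \<omega> \<beta> \<le> monom_weight \<omega> \<alpha>).
        Poly_Mapping.single \<alpha> (Poly_Mapping.lookup p \<alpha>))"

end

theory Submission
  imports Defs
begin

text \<open>
  Let \<open>d\<close> be the weight of the initial form \<open>f\<close> of \<open>\<phi>\<close>, and work in \<open>n\<close> variables.  The \<open>(i,j)\<close>
  entry of the Hessian of \<open>\<phi>\<close> has weight at most \<open>d - \<omega>\<^sub>i - \<omega>\<^sub>j\<close>, and its part of exactly that
  weight is the corresponding entry of the Hessian of \<open>f\<close>.  Every row and every column index
  occurs once in each term of the Leibniz expansion, so all terms have the same weight
  \<open>n d - 2 (\<Sum>\<^sub>i \<omega>\<^sub>i)\<close>, and the part of \<open>det (Hess \<phi>)\<close> of that weight is \<open>det (Hess f)\<close>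
  (\<open>leads_det_hessian\<close>).  This part is nonzero whereas \<open>det (Hess \<phi>)\<close> is a constant, so the weight
  is zero; with \<open>n = 4\<close> this says \<open>2 d = \<Sum>\<^sub>i \<omega>\<^sub>i\<close>.

  Now let \<open>\<omega>\<^sub>m\<close> be the largest weight.  If \<open>x\<^sub>m\<close> occurs in \<open>\<phi>\<close> at most linearly, then the coordinate
  direction \<open>e\<^sub>m\<close> is the required \<open>\<xi>\<close>.  Otherwise a monomial divisible by \<open>x\<^sub>m\<^sup>2\<close> occurs, and
  \<open>2 \<omega>\<^sub>m \<le> d\<close>, that is, \<open>4 \<omega>\<^sub>m \<le> \<Sum>\<^sub>i \<omega>\<^sub>i\<close>.  So all four weights are equal and \<open>d\<close> is twice their
  common value: \<open>\<phi>\<close> has degree at most two.  Degree two is excluded, and for a smaller degree the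
  Hessian would vanish.
\<close>

section \<open>Leading parts with respect to a weight\<close>

text \<open>
  Leading parts are treated as a relation and not as an operator that extracts the part of weight
  \<open>a\<close>.  The leading part may be zero, so the relation survives cancellation in sums, and
  it is compatible with all ring operations.
\<close>

definition leads :: "real ^ 'n \<Rightarrow> real \<Rightarrow> 'n::finite rpoly \<Rightarrow> 'n rpoly \<Rightarrow> bool" where
  "leads \<omega> a f p \<longleftrightarrow>
     (\<forall>\<alpha>\<in>Poly_Mapping.keys f. monom_weight \<omega> \<alpha> = a) \<and>
     (\<forall>\<alpha>\<in>Poly_Mapping.keys (p - f). monom_weight \<omega> \<alpha> < a)"

lemma monom_weight_0 [simp]: "monom_weight \<omega> 0 = 0"
  by (simp add: monom_weight_def)

lemma monom_weight_add: "monom_weight \<omega> (\<alpha> + \<beta>) = monom_weight \<omega> \<alpha> + monom_weight \<omega> \<beta>"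
  by (simp add: monom_weight_def lookup_add algebra_simps sum.distrib)

lemma monom_weight_single: "monom_weight \<omega> (Poly_Mapping.single i k) = \<omega> $ i * real k"
proof -
  have "monom_weight \<omega> (Poly_Mapping.single i k) = (\<Sum>j\<in>UNIV. if j = i then \<omega> $ i * real k else 0)"
    unfolding monom_weight_def
    by (intro sum.cong) (auto simp: lookup_single when_def)
  then show ?thesis
    by simp
qed

lemma monom_weight_nonneg: "(\<forall>i. \<omega> $ i > 0) \<Longrightarrow> monom_weight \<omega> \<alpha> \<ge> 0"
  by (simp add: monom_weight_def sum_nonneg less_imp_le)

lemma leads_le:
  assumes "leads \<omega> a f p" and "\<alpha> \<in> Poly_Mapping.keys p"
  shows "monom_weight \<omega> \<alpha> \<le> a"
proof -
  have "\<alpha> \<in> Poly_Mapping.keys f \<or> \<alpha> \<in> Poly_Mapping.keys (p - f)"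
    using assms(2) by (auto simp: in_keys_iff lookup_minus)
  then show ?thesis
    using assms(1) by (force simp: leads_def)
qed

lemma leads_keys:
  assumes "leads \<omega> a f p" and "\<alpha> \<in> Poly_Mapping.keys f"
  shows "\<alpha> \<in> Poly_Mapping.keys p" and "monom_weight \<omega> \<alpha> = a"
proof -
  show wt: "monom_weight \<omega> \<alpha> = a"
    using assms by (simp add: leads_def)
  then have "\<alpha> \<notin> Poly_Mapping.keys (p - f)"
    using assms(1) by (auto simp: leads_def)
  then show "\<alpha> \<in> Poly_Mapping.keys p"
    using assms(2) by (auto simp: in_keys_iff lookup_minus)
qed

lemma leads_zero: "leads \<omega> a 0 0"
  by (simp add: leads_def)

lemma leads_one: "leads \<omega> 0 1 1"
  by (simp add: leads_def)

lemma leads_uminus: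
  assumes "leads \<omega> a f p"
  shows "leads \<omega> a (- f) (- p)"
proof -
  have "Poly_Mapping.keys (- p - - f) = Poly_Mapping.keys (p - f)"
    by (auto simp: in_keys_iff lookup_minus)
  then show ?thesis
    using assms by (simp add: leads_def)
qed

lemma leads_add:
  assumes "leads \<omega> a f p" and "leads \<omega> a g q"
  shows "leads \<omega> a (f + g) (p + q)"
proof -
  have "Poly_Mapping.keys (f + g) \<subseteq> Poly_Mapping.keys f \<union> Poly_Mapping.keys g"
    by (rule Poly_Mapping.keys_add)
  moreover have "Poly_Mapping.keys (p + q - (f + g))
      \<subseteq> Poly_Mapping.keys (p - f) \<union> Poly_Mapping.keys (q - g)"
    using Poly_Mapping.keys_add[of "p - f" "q - g"] by (simp add: algebra_simps)
  ultimately show ?thesis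
    using assms unfolding leads_def by blast
qed

lemma leads_mult:
  assumes p: "leads \<omega> a f p" and q: "leads \<omega> b g q"
  shows "leads \<omega> (a + b) (f * g) (p * q)"
proof -
  have "monom_weight \<omega> \<gamma> = a + b" if "\<gamma> \<in> Poly_Mapping.keys (f * g)" for \<gamma>
    using that keys_mult[of f g] p q by (force simp: leads_def monom_weight_add)
  moreover have "monom_weight \<omega> \<gamma> < a + b" if "\<gamma> \<in> Poly_Mapping.keys (p * q - f * g)" for \<gamma>
  proof -
    \<comment> \<open>In either summand one factor has lost its leading part, which makes the weight drop.\<close>
    have "p * q - f * g = (p - f) * q + f * (q - g)"
      by (simp add: algebra_simps)
    then have "\<gamma> \<in> Poly_Mapping.keys ((p - f) * q) \<or> \<gamma> \<in> Poly_Mapping.keys (f * (q - g))"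
      using that Poly_Mapping.keys_add[of "(p - f) * q" "f * (q - g)"] by auto
    then show ?thesis
    proof
      assume "\<gamma> \<in> Poly_Mapping.keys ((p - f) * q)"
      then obtain \<alpha> \<beta> where "\<gamma> = \<alpha> + \<beta>" "\<alpha> \<in> Poly_Mapping.keys (p - f)" "\<beta> \<in> Poly_Mapping.keys q"
        using keys_mult[of "p - f" q] by blast
      then show ?thesis
        using p leads_le[OF q, of \<beta>] by (auto simp: leads_def monom_weight_add add_less_le_mono)
    next
      assume "\<gamma> \<in> Poly_Mapping.keys (f * (q - g))"
      then obtain \<alpha> \<beta> where "\<gamma> = \<alpha> + \<beta>" "\<alpha> \<in> Poly_Mapping.keys f" "\<beta> \<in> Poly_Mapping.keys (q - g)"
        using keys_mult[of f "q - g"] by blast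
      then show ?thesis
        using p q by (auto simp: leads_def monom_weight_add)
    qed
  qed
  ultimately show ?thesis
    by (simp add: leads_def)
qed

lemma leads_sum:
  assumes "\<And>s. s \<in> S \<Longrightarrow> leads \<omega> a (f s) (p s)"
  shows "leads \<omega> a (sum f S) (sum p S)"
  using assms by (induction S rule: infinite_finite_induct) (auto intro: leads_zero leads_add)

lemma leads_prod:
  assumes "finite S" and "\<And>s. s \<in> S \<Longrightarrow> leads \<omega> (a s) (f s) (p s)"
  shows "leads \<omega> (sum a S) (prod f S) (prod p S)"
  using assms by (induction S rule: finite_induct) (auto intro: leads_one leads_mult)

lemma leads_partial_deriv:
  assumes "leads \<omega> a f p"
  shows "leads \<omega> (a - \<omega> $ i) (partial_deriv i f) (partial_deriv i p)"
proof -
  have diff: "partial_deriv i p - partial_deriv i f = partial_deriv i (p - f)"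
    by (rule poly_mapping_eqI) (simp add: lookup_minus lookup_partial_deriv algebra_simps)
  have "\<beta> + Poly_Mapping.single i 1 \<in> Poly_Mapping.keys r"
    if "\<beta> \<in> Poly_Mapping.keys (partial_deriv i r)" for \<beta> and r :: "'a rpoly"
    using that by (simp add: in_keys_iff lookup_partial_deriv)
  then show ?thesis
    using assms unfolding leads_def diff
    by (fastforce simp: monom_weight_add monom_weight_single)
qed

lemma leads_initial_form:
  fixes p :: "'n::finite rpoly"
  assumes "p \<noteq> 0"
  shows "\<exists>d. leads \<omega> d (initial_form \<omega> p) p"
proof -
  let ?K = "Poly_Mapping.keys p"
  define d where "d = Max (monom_weight \<omega> ` ?K)"
  have le: "monom_weight \<omega> \<alpha> \<le> d" if "\<alpha> \<in> ?K" for \<alpha>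
    using that by (simp add: d_def)
  have "d \<in> monom_weight \<omega> ` ?K"
    unfolding d_def using assms by (intro Max_in) auto
  then have maximal_iff: "(\<forall>\<beta>\<in>?K. monom_weight \<omega> \<beta> \<le> monom_weight \<omega> \<alpha>) \<longleftrightarrow> monom_weight \<omega> \<alpha> = d"
    if "\<alpha> \<in> ?K" for \<alpha>
    using that le by (metis antisym imageE)
  have "Poly_Mapping.lookup (initial_form \<omega> p) \<alpha> =
      (if monom_weight \<omega> \<alpha> = d then Poly_Mapping.lookup p \<alpha> else 0)" for \<alpha>
    unfolding initial_form_def lookup_sum
    by (auto simp: lookup_single when_def maximal_iff in_keys_iff cong: conj_cong)
  then have "leads \<omega> d (initial_form \<omega> p) p"
    unfolding leads_def using le
    by (auto simp: in_keys_iff lookup_minus order_less_le split: if_splits)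
  then show ?thesis ..
qed

section \<open>The leading part of a Hessian determinant\<close>

text \<open>
  The weights \<open>a - \<omega>\<^sub>i - \<omega>\<^sub>j\<close> of the entries are sums of a row and a column contribution, so
  each term of the Leibniz expansion has the same total weight.
\<close>

lemma leads_det_hessian:
  fixes p f :: "'n::finite rpoly"
  assumes "leads \<omega> a f p"
  shows "leads \<omega> (real CARD('n) * a - 2 * (\<Sum>i\<in>UNIV. \<omega> $ i)) (det (hessian f)) (det (hessian p))"
  unfolding det_def
proof (rule leads_sum)
  fix \<pi> :: "'n \<Rightarrow> 'n"
  assume "\<pi> \<in> {\<pi>. \<pi> permutes UNIV}"
  then have perm: "\<pi> permutes UNIV"
    by simp
  let ?W = "real CARD('n) * a - 2 * (\<Sum>i\<in>UNIV. \<omega> $ i)"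
  have entry: "leads \<omega> (a - \<omega> $ \<pi> i - \<omega> $ i) (hessian f $ i $ \<pi> i) (hessian p $ i $ \<pi> i)" for i
    by (simp add: hessian_def leads_partial_deriv assms)
  have "(\<Sum>i\<in>UNIV. \<omega> $ \<pi> i) = (\<Sum>i\<in>UNIV. \<omega> $ i)"
    using sum.permute[OF perm, of "\<lambda>i. \<omega> $ i"] by (simp add: comp_def)
  then have weight: "(\<Sum>i\<in>UNIV. a - \<omega> $ \<pi> i - \<omega> $ i) = ?W"
    by (simp add: sum_subtractf)
  have prod: "leads \<omega> ?W (\<Prod>i\<in>UNIV. hessian f $ i $ \<pi> i) (\<Prod>i\<in>UNIV. hessian p $ i $ \<pi> i)"
    unfolding weight[symmetric] by (intro leads_prod entry finite)
  show "leads \<omega> ?W (of_int (sign \<pi>) * (\<Prod>i\<in>UNIV. hessian f $ i $ \<pi> i))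
      (of_int (sign \<pi>) * (\<Prod>i\<in>UNIV. hessian p $ i $ \<pi> i))"
    using prod leads_uminus[OF prod] by (cases rule: sign_cases[of \<pi>]) simp_all
qed

text \<open>
  A nonzero leading part consists of monomials of the polynomial that it leads, and the only monomial
  of a constant has weight zero.
\<close>

lemma weight_initial_form_of_constant_det_hessian:
  fixes p f :: "'n::finite rpoly"
  assumes "leads \<omega> d f p" and "det (hessian p) = const_poly c" and "det (hessian f) \<noteq> 0"
  shows "real CARD('n) * d = 2 * (\<Sum>i\<in>UNIV. \<omega> $ i)"
proof -
  obtain \<alpha> where \<alpha>: "\<alpha> \<in> Poly_Mapping.keys (det (hessian f))"
    using assms(3) by (metis all_not_in_conv keys_eq_empty)
  note key = leads_keys[OF leads_det_hessian[OF assms(1)] \<alpha>]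
  have "\<alpha> = 0"
    using key(1) by (auto simp: assms(2) const_poly_def split: if_splits)
  then show ?thesis
    using key(2) by simp
qed

section \<open>Occurring monomials and vanishing derivatives\<close>

lemma total_degree_le:
  assumes "\<And>\<alpha>. \<alpha> \<in> Poly_Mapping.keys p \<Longrightarrow> (\<Sum>i\<in>UNIV. Poly_Mapping.lookup \<alpha> i) \<le> k"
  shows "total_degree p \<le> k"
  using assms by (simp add: total_degree_def)

lemma le_total_degree:
  assumes "\<alpha> \<in> Poly_Mapping.keys p"
  shows "(\<Sum>i\<in>UNIV. Poly_Mapping.lookup \<alpha> i) \<le> total_degree p"
  unfolding total_degree_def using assms by (intro Max_ge) auto

lemma second_partial_deriv_key:
  assumes "\<beta> \<in> Poly_Mapping.keys (partial_deriv i (partial_deriv j p))"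
  shows "\<beta> + Poly_Mapping.single i 1 + Poly_Mapping.single j 1 \<in> Poly_Mapping.keys p"
  using assms by (simp add: in_keys_iff lookup_partial_deriv)

lemma hessian_eq_0:
  fixes p :: "'n::finite rpoly"
  assumes "total_degree p < 2"
  shows "hessian p = 0"
proof -
  have "partial_deriv i (partial_deriv j p) = 0" for i j
  proof (rule ccontr)
    assume "partial_deriv i (partial_deriv j p) \<noteq> 0"
    then obtain \<beta> where "\<beta> \<in> Poly_Mapping.keys (partial_deriv i (partial_deriv j p))"
      by (metis all_not_in_conv keys_eq_empty)
    from le_total_degree[OF second_partial_deriv_key[OF this]]
    have "(\<Sum>k\<in>UNIV. Poly_Mapping.lookup (Poly_Mapping.single i 1 + Poly_Mapping.single j 1) k)
        \<le> total_degree p"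
      by (simp add: lookup_add sum.distrib)
    then show False
      using assms by (simp add: lookup_add sum.distrib lookup_single when_def)
  qed
  then show ?thesis
    by (simp add: hessian_def vec_eq_iff)
qed

lemma dir_deriv_axis: "dir_deriv (axis m 1) p = partial_deriv m p"
proof -
  have "dir_deriv (axis m 1) p = (\<Sum>i\<in>UNIV. if i = m then partial_deriv m p else 0)"
    unfolding dir_deriv_def
    by (intro sum.cong) (auto simp: const_poly_def axis_def)
  then show ?thesis
    by simp
qed

section \<open>Polynomials in four variables with constant Hessian determinant\<close>

theorem theorem3p4:
  fixes \<phi> :: "4 rpoly" and \<omega> :: "real ^ 4"
  assumes nonquadratic: "total_degree \<phi> \<noteq> 2"
    and det_const: "\<exists>c. c \<noteq> 0 \<and> det (hessian \<phi>) = const_poly c"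
    and weights_pos: "\<forall>i. \<omega> $ i > 0"
    and det_initial: "det (hessian (initial_form \<omega> \<phi>)) \<noteq> 0"
  shows "\<exists>\<xi> :: real ^ 4. \<xi> \<noteq> 0 \<and> dir_deriv \<xi> (dir_deriv \<xi> \<phi>) = 0"
proof -
  obtain c where "c \<noteq> 0" and det: "det (hessian \<phi>) = const_poly c"
    using det_const by blast
  moreover have "det (0 :: 4 rpoly ^ 4 ^ 4) = 0"
    by (simp add: det_def)
  ultimately have "hessian \<phi> \<noteq> 0"
    by (metis const_poly_def lookup_single_eq lookup_zero)
  then have deg: "total_degree \<phi> > 2"
    using hessian_eq_0[of \<phi>] nonquadratic by linarith
  then have "\<phi> \<noteq> 0"
    by (auto simp: total_degree_def)
  then obtain d where lead: "leads \<omega> d (initial_form \<omega> \<phi>) \<phi>"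
    using leads_initial_form by blast
  have d: "2 * d = (\<Sum>i\<in>UNIV. \<omega> $ i)"
    using weight_initial_form_of_constant_det_hessian[OF lead det det_initial] by simp
  have "Max (range (($) \<omega>)) \<in> range (($) \<omega>)"
    by (intro Max_in) auto
  then obtain m where max: "Max (range (($) \<omega>)) = \<omega> $ m"
    by blast
  have m: "\<omega> $ i \<le> \<omega> $ m" for i
    unfolding max[symmetric] by (intro Max_ge) auto
  have "partial_deriv m (partial_deriv m \<phi>) = 0"
  proof (rule ccontr)
    assume "partial_deriv m (partial_deriv m \<phi>) \<noteq> 0"
    then obtain \<beta> where "\<beta> \<in> Poly_Mapping.keys (partial_deriv m (partial_deriv m \<phi>))"
      by (metis all_not_in_conv keys_eq_empty)
    from leads_le[OF lead second_partial_deriv_key[OF this]]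
    have "2 * \<omega> $ m \<le> d"
      using monom_weight_nonneg[OF weights_pos, of \<beta>]
      by (simp add: monom_weight_add monom_weight_single)
    then have "(\<Sum>i\<in>UNIV. \<omega> $ m - \<omega> $ i) \<le> 0"
      using d by (simp add: sum_subtractf)
    moreover have "(\<Sum>i\<in>UNIV. \<omega> $ m - \<omega> $ i) \<ge> 0"
      by (intro sum_nonneg) (simp add: m)
    ultimately have "(\<Sum>i\<in>UNIV. \<omega> $ m - \<omega> $ i) = 0"
      by linarith
    then have "\<forall>i. \<omega> $ m - \<omega> $ i = 0"
      by (subst (asm) sum_nonneg_eq_0_iff) (auto simp: m)
    then obtain w where equal: "\<omega> $ i = w" for i
      by (metis eq_iff_diff_eq_0)
    have "d = 2 * w"
      using d by (simp add: equal)
    moreover have "monom_weight \<omega> \<alpha> = w * real (\<Sum>i\<in>UNIV. Poly_Mapping.lookup \<alpha> i)" for \<alpha>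
      by (simp add: monom_weight_def equal sum_distrib_left)
    ultimately have "real (\<Sum>i\<in>UNIV. Poly_Mapping.lookup \<alpha> i) \<le> 2"
      if "\<alpha> \<in> Poly_Mapping.keys \<phi>" for \<alpha>
      using leads_le[OF lead that] weights_pos by (simp add: equal mult.commute)
    then have "total_degree \<phi> \<le> 2"
      by (intro total_degree_le) (metis of_nat_le_iff of_nat_numeral)
    then show False
      using deg by simp
  qed
  then show ?thesis
    by (intro exI[of _ "axis m 1"]) (simp add: dir_deriv_axis)
qed

end
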